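(* There is a (bounded) weighted shift $S_{\boldsymbol{\lambda}}\in\mathcal{B}(\ell^2(V^0))$ on the directed tree $\mathcal{T}^0=(V^0,E^0)$ which is cyclic.
   Context: $\mathcal{T}^0=(V^0,E^0)$ is the directed tree with vertex set $V^0=\mathbb{Z}\cup\{k'\colon k\in\mathbb{N}\}$ (the primed symbols $1',2',\dots$ are distinct additional vertices) and edge set $E^0=\{(k,k+1)\colon k\in\mathbb{Z}\}\cup\{(0,1')\}\cup\{(k',(k+1)')\colon k\in\mathbb{N}\}$. For $u\in V^0$, $\mathrm{Chi}(u)=\{v\in V^0\colon(u,v)\in E^0\}$. Given a bounded family of positive weights $\boldsymbol{\lambda}=\{\lambda_v\colon v\in V^0\}\subseteq(0,\infty)$, the weighted shift $S_{\boldsymbol{\lambda}}$ is the bounded operator on the complex Hilbert space $\ell^2(V^0)$ (with orthonormal basis $\{e_u\}_{u\in V^0}$) given by $S_{\boldsymbol{\lambda}}e_u=\sum_{v\in\mathrm{Chi}(u)}\lambda_ve_v$ (all weights of a weighted shift are required to be positive). An operator $T\in\mathcal{B}(\mathcal{H})$ is cyclic if there is $h\in\mathcal{H}$ such that the closed linear span of $\{T^nh\colon n\ge0\}$ is $\mathcal{H}$. *)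

theory Defs
  imports "HOL-Analysis.Analysis"
begin

section \<open>The complex Hilbert space of square-summable functions\<close>

typedef 'a ell2 = "{f :: 'a \<Rightarrow> complex. (\<lambda>v. (cmod (f v))\<^sup>2) summable_on UNIV}"
  by (rule exI[of _ "\<lambda>_. 0"]) simp

setup_lifting type_definition_ell2

lemma square_summable_add:
  fixes f g :: "'a \<Rightarrow> complex"
  assumes "(\<lambda>v. (cmod (f v))\<^sup>2) summable_on UNIV" "(\<lambda>v. (cmod (g v))\<^sup>2) summable_on UNIV"
  shows "(\<lambda>v. (cmod (f v + g v))\<^sup>2) summable_on UNIV"
proof (rule summable_on_comparison_test)
  show "(\<lambda>v. 2 * (cmod (f v))\<^sup>2 + 2 * (cmod (g v))\<^sup>2) summable_on UNIV"
    by (intro summable_on_add summable_on_cmult_right assms)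
  fix v
  have "(cmod (f v + g v))\<^sup>2 \<le> (cmod (f v) + cmod (g v))\<^sup>2"
    by (intro power_mono norm_triangle_ineq) auto
  also have "\<dots> \<le> 2 * (cmod (f v))\<^sup>2 + 2 * (cmod (g v))\<^sup>2"
    using sum_squares_bound[of "cmod (f v)" "cmod (g v)"] by (simp add: power2_sum)
  finally show "(cmod (f v + g v))\<^sup>2 \<le> 2 * (cmod (f v))\<^sup>2 + 2 * (cmod (g v))\<^sup>2" .
qed auto

lemma square_summable_scale:
  fixes f :: "'a \<Rightarrow> complex"
  assumes "(\<lambda>v. (cmod (f v))\<^sup>2) summable_on UNIV"
  shows "(\<lambda>v. (cmod (c * f v))\<^sup>2) summable_on UNIV"
  using assms by (simp add: norm_mult power_mult_distrib summable_on_cmult_right)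

lemma square_summable_inner:
  fixes f g :: "'a \<Rightarrow> complex"
  assumes "(\<lambda>v. (cmod (f v))\<^sup>2) summable_on UNIV" "(\<lambda>v. (cmod (g v))\<^sup>2) summable_on UNIV"
  shows "(\<lambda>v. f v \<bullet> g v) summable_on UNIV"
proof -
  have "(\<lambda>v. (1/2) * ((cmod (f v + g v))\<^sup>2 + (- 1) * (cmod (f v))\<^sup>2 + (- 1) * (cmod (g v))\<^sup>2))
          summable_on UNIV"
    by (intro summable_on_add summable_on_cmult_right square_summable_add assms)
  moreover have "(1/2) * ((cmod (f v + g v))\<^sup>2 + (- 1) * (cmod (f v))\<^sup>2 + (- 1) * (cmod (g v))\<^sup>2)
      = f v \<bullet> g v" for v
    by (simp add: power2_norm_eq_inner inner_add_left inner_add_right inner_commute)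
  ultimately show ?thesis by simp
qed

text \<open>Complex scalar multiplication; the distribution has no type class of complex vector spaces.\<close>

lift_definition scaleC :: "complex \<Rightarrow> 'a ell2 \<Rightarrow> 'a ell2" (infixr "*\<^sub>C" 75)
  is "\<lambda>c f v. c * f v"
  by (rule square_summable_scale)

instantiation ell2 :: (type) real_vector
begin

lift_definition zero_ell2 :: "'a ell2" is "\<lambda>_. 0" by simp

lift_definition plus_ell2 :: "'a ell2 \<Rightarrow> 'a ell2 \<Rightarrow> 'a ell2" is "\<lambda>f g v. f v + g v"
  by (rule square_summable_add)

lift_definition uminus_ell2 :: "'a ell2 \<Rightarrow> 'a ell2" is "\<lambda>f v. - f v" by simp

definition minus_ell2 :: "'a ell2 \<Rightarrow> 'a ell2 \<Rightarrow> 'a ell2" where "minus_ell2 x y = x + - y"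

definition scaleR_ell2 :: "real \<Rightarrow> 'a ell2 \<Rightarrow> 'a ell2" where "scaleR_ell2 r x = of_real r *\<^sub>C x"

instance
  by standard
    (unfold minus_ell2_def scaleR_ell2_def, (transfer, simp add: fun_eq_iff algebra_simps)+)

end

text \<open>The real inner product is the real part of \<open>\<Sum>v. x v * cnj (y v)\<close>; the norm is the usual one.\<close>

instantiation ell2 :: (type) real_inner
begin

lift_definition inner_ell2 :: "'a ell2 \<Rightarrow> 'a ell2 \<Rightarrow> real" is "\<lambda>f g. \<Sum>\<^sub>\<infinity>v. f v \<bullet> g v" .

lift_definition norm_ell2 :: "'a ell2 \<Rightarrow> real" is "\<lambda>f. sqrt (\<Sum>\<^sub>\<infinity>v. (cmod (f v))\<^sup>2)" .

definition dist_ell2 :: "'a ell2 \<Rightarrow> 'a ell2 \<Rightarrow> real" where "dist_ell2 x y = norm (x - y)"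

definition sgn_ell2 :: "'a ell2 \<Rightarrow> 'a ell2" where "sgn_ell2 x = x /\<^sub>R norm x"

definition uniformity_ell2 :: "('a ell2 \<times> 'a ell2) filter" where
  "uniformity_ell2 = (INF e\<in>{0<..}. principal {(x, y). dist x y < e})"

definition open_ell2 :: "'a ell2 set \<Rightarrow> bool" where
  "open_ell2 U = (\<forall>x\<in>U. \<forall>\<^sub>F (x', y) in uniformity. x' = x \<longrightarrow> y \<in> U)"

instance
proof
  fix x y z :: "'a ell2" and r :: real
  show "dist x y = norm (x - y)" by (rule dist_ell2_def)
  show "sgn x = x /\<^sub>R norm x" by (rule sgn_ell2_def)
  show "(uniformity :: ('a ell2 \<times> 'a ell2) filter) = (INF e\<in>{0<..}. principal {(x, y). dist x y < e})"
    by (rule uniformity_ell2_def)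
  show "x \<bullet> y = y \<bullet> x"
    by transfer (simp add: inner_commute)
  show "(x + y) \<bullet> z = x \<bullet> z + y \<bullet> z"
    by transfer (simp add: inner_add_left infsum_add square_summable_inner)
  show "(r *\<^sub>R x) \<bullet> y = r * (x \<bullet> y)"
  proof -
    have "(complex_of_real r * a) \<bullet> b = r * (a \<bullet> b)" for a b :: complex
      by (simp add: scaleR_conv_of_real[symmetric])
    then show ?thesis
      unfolding scaleR_ell2_def by transfer (simp add: infsum_cmult_right')
  qed
  show "0 \<le> x \<bullet> x"
    by transfer (simp add: infsum_nonneg)
  show "x \<bullet> x = 0 \<longleftrightarrow> x = 0"
  proof transfer
    fix f :: "'a \<Rightarrow> complex"
    assume f: "(\<lambda>v. (cmod (f v))\<^sup>2) summable_on UNIV"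
    show "(\<Sum>\<^sub>\<infinity>v. f v \<bullet> f v) = 0 \<longleftrightarrow> f = (\<lambda>_. 0)"
    proof
      assume "(\<Sum>\<^sub>\<infinity>v. f v \<bullet> f v) = 0"
      then have "(cmod (f v))\<^sup>2 = 0" for v
        using f by (intro nonneg_infsum_le_0D[where A = UNIV]) (auto simp: power2_norm_eq_inner)
      then show "f = (\<lambda>_. 0)" by auto
    qed simp
  qed
  show "norm x = sqrt (x \<bullet> x)"
    by transfer (simp add: power2_norm_eq_inner)
qed (simp add: open_ell2_def)

end

interpretation ell2: vector_space "scaleC :: complex \<Rightarrow> 'a ell2 \<Rightarrow> 'a ell2"
  by standard (transfer, simp add: fun_eq_iff algebra_simps)+

lift_definition ket :: "'a \<Rightarrow> 'a ell2" is "\<lambda>u v. if v = u then 1 else 0"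
  by (rule summable_on_cong_neutral[THEN iffD1, OF _ _ _ summable_on_finite[of "{u}" "\<lambda>_. 1" for u]]) auto

definition bounded_operator :: "('a ell2 \<Rightarrow> 'a ell2) \<Rightarrow> bool" where
  "bounded_operator T \<longleftrightarrow> bounded_linear T \<and> (\<forall>c x. T (c *\<^sub>C x) = c *\<^sub>C T x)"

text \<open>\<open>ell2.span\<close> is the span over the complex numbers.\<close>

definition cyclic :: "('a ell2 \<Rightarrow> 'a ell2) \<Rightarrow> bool" where
  "cyclic T \<longleftrightarrow> (\<exists>h. closure (ell2.span (range (\<lambda>n. (T ^^ n) h))) = UNIV)"


section \<open>The directed tree and its weighted shifts\<close>

text \<open>\<open>Unprimed k\<close> is the vertex \<open>k\<close>. The primed vertices start at \<open>1'\<close>, whereas \<open>nat\<close> starts at \<open>0\<close>: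
  \<open>Primed n\<close> is the vertex \<open>(n + 1)'\<close>. The vertex set is thus the whole type.\<close>

datatype vertex = Unprimed int | Primed nat

definition E0 :: "(vertex \<times> vertex) set" where
  "E0 = {(Unprimed k, Unprimed (k + 1)) | k. True} \<union> {(Unprimed 0, Primed 0)} \<union>
        {(Primed n, Primed (n + 1)) | n. True}"

definition Chi :: "vertex \<Rightarrow> vertex set" where
  "Chi u = {v. (u, v) \<in> E0}"

text \<open>In particular the sums over \<open>Chi u\<close> below are finite.\<close>

lemma Chi_Unprimed: "Chi (Unprimed k) = (if k = 0 then {Unprimed 1, Primed 0} else {Unprimed (k + 1)})"
  by (auto simp: Chi_def E0_def)

lemma Chi_Primed: "Chi (Primed n) = {Primed (n + 1)}"
  by (auto simp: Chi_def E0_def)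

lemma finite_Chi: "finite (Chi u)"
  by (cases u) (auto simp: Chi_Unprimed Chi_Primed)

definition weighted_shift :: "(vertex \<Rightarrow> real) \<Rightarrow> (vertex ell2 \<Rightarrow> vertex ell2) \<Rightarrow> bool" where
  "weighted_shift lam S \<longleftrightarrow>
     (\<forall>v. 0 < lam v) \<and> bounded (range lam) \<and> bounded_operator S \<and>
     (\<forall>u. S (ket u) = (\<Sum>v\<in>Chi u. of_real (lam v) *\<^sub>C ket v))"

end

theory Submission
  imports Defs
begin

text \<open>Take weights \<open>1\<close> up to \<open>0\<close> and rapidly decreasing to \<open>0\<close> along both branches, and let
  \<open>h = e\<^bsub>1'\<^esub> + (\<Sum>i. 2\<^bsup>-i\<^sup>2\<^esup> e\<^bsub>-i\<^sup>2\<^esub>)\<close>. For fixed \<open>m\<close>, suitable multiples of \<open>S\<^bsup>j\<^sup>2-m\<^esup> h\<close>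
  converge to \<open>e\<^bsub>-m\<^esub>\<close> as \<open>j \<longrightarrow> \<infinity>\<close>. Hence the closed cyclic subspace of \<open>h\<close> contains every \<open>e\<^bsub>-m\<^esub>\<close>,
  therefore also \<open>e\<^bsub>1'\<^esub>\<close>, the remaining summand of \<open>h\<close>. As \<open>S\<close> maps \<open>e\<^bsub>0\<^esub>\<close> to a combination of \<open>e\<^bsub>1\<^esub>\<close>
  and \<open>e\<^bsub>1'\<^esub>\<close>, it contains \<open>e\<^bsub>1\<^esub>\<close> too, and by invariance all basis vectors.\<close>

section \<open>Square-summable functions\<close>

lemma summable_Rep_ell2: "(\<lambda>v. (cmod (Rep_ell2 x v))\<^sup>2) summable_on UNIV"
  using Rep_ell2[of x] by simp

lemma norm_ell2_power2: "(norm x)\<^sup>2 = (\<Sum>\<^sub>\<infinity>v. (cmod (Rep_ell2 x v))\<^sup>2)"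
  by transfer (simp add: infsum_nonneg)

lemma Rep_ell2_diff: "Rep_ell2 (x - y) v = Rep_ell2 x v - Rep_ell2 y v"
  unfolding minus_ell2_def plus_ell2.rep_eq uminus_ell2.rep_eq by simp

lemma Rep_ell2_scaleR: "Rep_ell2 (r *\<^sub>R x) v = of_real r * Rep_ell2 x v"
  by (simp add: scaleR_ell2_def scaleC.rep_eq)

lemma Rep_ell2_sum: "Rep_ell2 (sum f A) v = (\<Sum>i\<in>A. Rep_ell2 (f i) v)"
  by (induction A rule: infinite_finite_induct) (simp_all add: zero_ell2.rep_eq plus_ell2.rep_eq)

lemma ell2_eqI: "(\<And>v. Rep_ell2 x v = Rep_ell2 y v) \<Longrightarrow> x = y"
  by (simp add: Rep_ell2_inject[symmetric] fun_eq_iff)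

lemma norm_scaleC: "norm (c *\<^sub>C x) = cmod c * norm x"
proof -
  have "(norm (c *\<^sub>C x))\<^sup>2 = (cmod c * norm x)\<^sup>2"
    by (simp add: norm_ell2_power2 scaleC.rep_eq norm_mult power_mult_distrib infsum_cmult_right')
  then show ?thesis by simp
qed

lemma norm_ket: "norm (ket u) = 1"
proof -
  have "(norm (ket u))\<^sup>2 = (\<Sum>\<^sub>\<infinity>v. (if v = u then 1 else 0 :: real))"
    unfolding norm_ell2_power2 by (rule infsum_cong) (simp add: ket.rep_eq)
  also have "\<dots> = (\<Sum>\<^sub>\<infinity>v\<in>{u}. 1)"
    by (rule infsum_cong_neutral) auto
  finally show ?thesis
    using norm_ge_zero[of "ket u"] by (simp add: power2_eq_1_iff)
qed

lemma norm_ell2_mono: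
  assumes "\<And>v. cmod (Rep_ell2 x v) \<le> C * cmod (Rep_ell2 y v)" "C \<ge> 0"
  shows "norm x \<le> C * norm y"
proof -
  have "(norm x)\<^sup>2 \<le> (\<Sum>\<^sub>\<infinity>v. C\<^sup>2 * (cmod (Rep_ell2 y v))\<^sup>2)"
    unfolding norm_ell2_power2
    using power_mono[OF assms(1), of _ 2]
    by (intro infsum_mono summable_Rep_ell2 summable_on_cmult_right) (simp add: power_mult_distrib)
  also have "\<dots> = (C * norm y)\<^sup>2"
    by (simp add: norm_ell2_power2 power_mult_distrib infsum_cmult_right')
  finally show ?thesis
    using assms(2) by (simp add: power2_le_iff_abs_le)
qed

section \<open>Closed complex subspaces and density of the basis vectors\<close>

lemma bounded_linear_scaleC: "bounded_linear (\<lambda>x. c *\<^sub>C x)"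
proof (rule bounded_linear_intro[of _ "cmod c"])
  show "c *\<^sub>C (x + y) = c *\<^sub>C x + c *\<^sub>C y" for x y :: "'a ell2"
    by (rule ell2.scale_right_distrib)
  show "c *\<^sub>C (r *\<^sub>R x) = r *\<^sub>R (c *\<^sub>C x)" for r and x :: "'a ell2"
    by (simp add: scaleR_ell2_def mult.commute)
qed (simp add: norm_scaleC mult.commute)

text \<open>Finite truncations of \<open>x\<close> lie in the span, and their squared distance to
  \<open>x\<close> is the remainder of a convergent series.\<close>

lemma closure_span_ket: "closure (ell2.span (range ket)) = (UNIV :: 'a ell2 set)"
proof -
  have "\<exists>y\<in>ell2.span (range ket). dist y x < e" if "e > 0" for x :: "'a ell2" and e
  proof -
    let ?f = "\<lambda>v. (cmod (Rep_ell2 x v))\<^sup>2"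
    have "(?f has_sum infsum ?f UNIV) UNIV"
      using summable_Rep_ell2 by (rule has_sum_infsum)
    then have "\<forall>\<^sub>F F in finite_subsets_at_top UNIV. dist (sum ?f F) (infsum ?f UNIV) < e\<^sup>2"
      using \<open>e > 0\<close> unfolding has_sum_def tendsto_iff by simp
    then obtain F where F: "finite F" "dist (sum ?f F) (infsum ?f UNIV) < e\<^sup>2"
      unfolding eventually_finite_subsets_at_top by blast
    define y where "y = (\<Sum>v\<in>F. Rep_ell2 x v *\<^sub>C ket v)"
    have y: "Rep_ell2 y v = (if v \<in> F then Rep_ell2 x v else 0)" for v
      using F(1) by (simp add: y_def Rep_ell2_sum scaleC.rep_eq ket.rep_eq if_distrib sum.delta cong: if_cong)
    have "(norm (y - x))\<^sup>2 = (\<Sum>\<^sub>\<infinity>v\<in>-F. ?f v)"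
      unfolding norm_ell2_power2
      by (rule infsum_cong_neutral) (auto simp: Rep_ell2_diff y)
    also have "\<dots> = infsum ?f UNIV - sum ?f F"
      using infsum_Diff[of ?f UNIV F] F(1) summable_Rep_ell2[of x]
      by (simp add: Compl_eq_Diff_UNIV summable_on_finite)
    also have "\<dots> < e\<^sup>2" using F(2) by (simp add: dist_real_def)
    finally have "norm (y - x) < e" using \<open>e > 0\<close> by (simp add: power2_less_imp_less)
    moreover have "y \<in> ell2.span (range ket)"
      unfolding y_def by (intro ell2.span_sum ell2.span_scale ell2.span_base) auto
    ultimately show ?thesis by (auto simp: dist_norm)
  qed
  then show ?thesis by (auto simp: closure_approachable)
qed

lemma ell2_subspace_closure:
  fixes M :: "'a ell2 set"
  assumes "ell2.subspace M"
  shows "ell2.subspace (closure M)"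
proof -
  have "x + y \<in> closure M" if "x \<in> closure M" "y \<in> closure M" for x y
  proof -
    obtain f g where "\<And>n. f n \<in> M" "f \<longlonglongrightarrow> x" "\<And>n. g n \<in> M" "g \<longlonglongrightarrow> y"
      using \<open>x \<in> closure M\<close> \<open>y \<in> closure M\<close> unfolding closure_sequential by metis
    then have "\<forall>n. f n + g n \<in> M" "(\<lambda>n. f n + g n) \<longlonglongrightarrow> x + y"
      using assms by (auto simp: ell2.subspace_def intro: tendsto_add)
    then show ?thesis unfolding closure_sequential by (intro exI conjI)
  qed
  moreover have "0 \<in> closure M"
    using assms closure_subset by (auto simp: ell2.subspace_def)
  moreover have "c *\<^sub>C x \<in> closure M" if "x \<in> closure M" for c x
  proof -
    have "(\<lambda>x. c *\<^sub>C x) ` closure M \<subseteq> closure ((\<lambda>x. c *\<^sub>C x) ` M)"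
      by (rule closure_bounded_linear_image_subset[OF bounded_linear_scaleC])
    also have "\<dots> \<subseteq> closure M"
      using assms by (intro closure_mono) (auto simp: ell2.subspace_def)
    finally show ?thesis using that by auto
  qed
  ultimately show ?thesis by (auto simp: ell2.subspace_def)
qed

text \<open>\<open>T\<close> sends each orbit vector to the next one, hence the span into itself;
  continuity extends this to the closure.\<close>

lemma orbit_closure_invariant:
  assumes "bounded_operator T" "x \<in> closure (ell2.span (range (\<lambda>n. (T ^^ n) h)))"
  shows "T x \<in> closure (ell2.span (range (\<lambda>n. (T ^^ n) h)))"
proof -
  let ?M = "ell2.span (range (\<lambda>n. (T ^^ n) h))"
  have T: "bounded_linear T" "\<And>c x. T (c *\<^sub>C x) = c *\<^sub>C T x"
    using assms(1) by (auto simp: bounded_operator_def)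
  interpret T: bounded_linear T by (rule T)
  have "T y \<in> ?M" if "y \<in> ?M" for y
    using that
  proof (induction rule: ell2.span_induct_alt)
    case base
    then show ?case by (simp add: T.zero ell2.span_zero)
  next
    case (step c x y)
    then obtain n where "x = (T ^^ n) h" by auto
    then have "T x \<in> ?M" by (intro ell2.span_base) (auto intro: range_eqI[of _ _ "Suc n"])
    with step show ?case
      by (simp add: T.add T(2) ell2.span_add ell2.span_scale)
  qed
  then have "T ` ?M \<subseteq> ?M" by auto
  with closure_bounded_linear_image_subset[OF T(1), of ?M] closure_mono[of "T ` ?M" ?M] assms(2)
  show ?thesis by blast
qed


section \<open>The weighted shift\<close>

text \<open>Every vertex has exactly one parent, so the shift can be given coordinatewise, as
  composition with \<open>parent\<close> followed by multiplication by the weights.\<close>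

fun parent :: "vertex \<Rightarrow> vertex" where
  "parent (Unprimed k) = Unprimed (k - 1)"
| "parent (Primed 0) = Unprimed 0"
| "parent (Primed (Suc n)) = Primed n"

lemma parent_eq_iff: "parent v = u \<longleftrightarrow> v \<in> Chi u"
  by (cases v rule: parent.cases; cases u) (auto simp: Chi_Unprimed Chi_Primed)

text \<open>The exponents are consecutive odd numbers along either branch, so that the products of
  weights from \<open>0\<close> on are \<open>(1/2) ^ n\<^sup>2\<close>.\<close>

fun weight :: "vertex \<Rightarrow> real" where
  "weight (Unprimed k) = (if k \<le> 0 then 1 else (1/2) ^ (2 * nat k - 1))"
| "weight (Primed n) = (1/2) ^ (2 * n + 1)"

lemma weight_pos: "0 < weight v"
  by (cases v) auto

lemma weight_le_1: "weight v \<le> 1"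
proof (cases v)
  case (Primed n)
  then show ?thesis unfolding Primed weight.simps by (intro power_le_one) auto
qed (simp add: power_le_one)

text \<open>At the branching vertex both children have weight \<open>1/2\<close>, which gives
  \<open>1/4 + 1/4\<close>; every other vertex has a single child. The sum is the squared norm of
  the image of \<open>ket u\<close>, so this bound will make the shift a contraction.\<close>

lemma weight_Chi_le: "(\<Sum>v\<in>Chi u. (weight v)\<^sup>2) \<le> 1"
proof -
  have "(weight v)\<^sup>2 \<le> 1" for v
    using weight_pos[of v] weight_le_1[of v] by (simp add: power_le_one)
  moreover have "Unprimed 1 \<noteq> Primed 0" by simp
  ultimately show ?thesis
    by (cases u) (auto simp: Chi_Unprimed Chi_Primed power2_eq_square simp del: weight.simps,
      simp add: field_simps)
qed

text \<open>Grouping \<open>F\<close> by parents leaves in front of each coordinate of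
  \<open>x\<close> part of the sum bounded in \<open>weight_Chi_le\<close>. Since the bound is
  uniform in \<open>F\<close>, it yields both summability and the norm estimate for the
  shift.\<close>

lemma weighted_parent_sum_le:
  assumes "finite F"
  shows "(\<Sum>v\<in>F. (cmod (of_real (weight v) * Rep_ell2 x (parent v)))\<^sup>2) \<le> (norm x)\<^sup>2"
proof -
  let ?g = "\<lambda>u. (cmod (Rep_ell2 x u))\<^sup>2"
  have "(\<Sum>v\<in>F. (cmod (of_real (weight v) * Rep_ell2 x (parent v)))\<^sup>2)
      = (\<Sum>u\<in>parent ` F. \<Sum>v\<in>{v\<in>F. parent v = u}. (weight v)\<^sup>2 * ?g (parent v))"
    using assms by (subst sum.image_gen[where g = parent]) (simp_all add: norm_mult power_mult_distrib)
  also have "\<dots> = (\<Sum>u\<in>parent ` F. (\<Sum>v\<in>{v\<in>F. parent v = u}. (weight v)\<^sup>2) * ?g u)"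
    by (auto simp: sum_distrib_right intro!: sum.cong)
  also have "\<dots> \<le> (\<Sum>u\<in>parent ` F. 1 * ?g u)"
  proof (intro sum_mono mult_right_mono)
    fix u
    have "(\<Sum>v\<in>{v\<in>F. parent v = u}. (weight v)\<^sup>2) \<le> (\<Sum>v\<in>Chi u. (weight v)\<^sup>2)"
      by (intro sum_mono2 finite_Chi) (auto simp: parent_eq_iff)
    then show "(\<Sum>v\<in>{v\<in>F. parent v = u}. (weight v)\<^sup>2) \<le> 1"
      using weight_Chi_le[of u] by linarith
  qed auto
  also have "\<dots> \<le> (norm x)\<^sup>2"
    unfolding norm_ell2_power2 using assms
    by (simp add: finite_sum_le_infsum[OF summable_Rep_ell2])
  finally show ?thesis .
qed

lemma summable_weighted_parent:
  "(\<lambda>v. (cmod (of_real (weight v) * Rep_ell2 x (parent v)))\<^sup>2) summable_on UNIV"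
proof (rule nonneg_bdd_above_summable_on)
  show "bdd_above (sum (\<lambda>v. (cmod (of_real (weight v) * Rep_ell2 x (parent v)))\<^sup>2) ` {F. F \<subseteq> UNIV \<and> finite F})"
    by (rule bdd_aboveI2[where M = "(norm x)\<^sup>2"], rule weighted_parent_sum_le) simp
qed simp

lift_definition shift :: "vertex ell2 \<Rightarrow> vertex ell2"
  is "\<lambda>x v. of_real (weight v) * x (parent v)"
  subgoal for x
    using summable_weighted_parent[of "Abs_ell2 x"] by (simp add: Abs_ell2_inverse)
  done

lemma norm_shift_le: "norm (shift x) \<le> norm x"
proof -
  have "(norm (shift x))\<^sup>2 \<le> (norm x)\<^sup>2"
    unfolding norm_ell2_power2[of "shift x"] shift.rep_eq
    by (intro infsum_le_finite_sums summable_weighted_parent weighted_parent_sum_le)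
  then show ?thesis by simp
qed

lemma bounded_operator_shift: "bounded_operator shift"
proof -
  have C: "shift (c *\<^sub>C x) = c *\<^sub>C shift x" for c x
    by (rule ell2_eqI) (simp add: shift.rep_eq scaleC.rep_eq)
  have "bounded_linear shift"
  proof (rule bounded_linear_intro[of _ 1])
    show "shift (x + y) = shift x + shift y" for x y
      by (rule ell2_eqI) (simp add: shift.rep_eq plus_ell2.rep_eq algebra_simps)
    show "shift (r *\<^sub>R x) = r *\<^sub>R shift x" for r x
      by (simp add: scaleR_ell2_def C)
  qed (simp add: norm_shift_le)
  with C show ?thesis by (simp add: bounded_operator_def)
qed

lemma shift_ket: "shift (ket u) = (\<Sum>v\<in>Chi u. of_real (weight v) *\<^sub>C ket v)"
proof (rule ell2_eqI)
  fix v
  have "Rep_ell2 (shift (ket u)) v = (if v \<in> Chi u then of_real (weight v) else 0)"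
    by (simp add: shift.rep_eq ket.rep_eq parent_eq_iff)
  also have "\<dots> = Rep_ell2 (\<Sum>v\<in>Chi u. of_real (weight v) *\<^sub>C ket v) v"
    using finite_Chi[of u]
    by (simp add: Rep_ell2_sum scaleC.rep_eq ket.rep_eq if_distrib sum.delta cong: if_cong)
  finally show "Rep_ell2 (shift (ket u)) v = Rep_ell2 (\<Sum>v\<in>Chi u. of_real (weight v) *\<^sub>C ket v) v" .
qed

lemma weighted_shift_shift: "weighted_shift weight shift"
proof -
  have "bounded (range weight)"
    using weight_pos weight_le_1 by (intro boundedI[of _ 1]) (auto simp: less_imp_le)
  then show ?thesis
    by (simp add: weighted_shift_def weight_pos bounded_operator_shift shift_ket)
qed

section \<open>Powers of the shift on basis vectors\<close>

lemma bounded_linear_shift: "bounded_linear shift"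
  using bounded_operator_shift by (simp add: bounded_operator_def)

lemma bounded_linear_shift_power: "bounded_linear (shift ^^ n)"
  by (induction n) (auto simp: o_def id_def intro: bounded_linear_compose bounded_linear_shift bounded_linear_ident)

lemma norm_shift_power_le: "norm ((shift ^^ n) x) \<le> norm x"
  by (induction n) (auto intro: order_trans[OF norm_shift_le])

lemma shift_ket_nonpos: "k < 0 \<Longrightarrow> shift (ket (Unprimed k)) = ket (Unprimed (k + 1))"
  by (simp add: shift_ket Chi_Unprimed)

lemma shift_ket_0: "shift (ket (Unprimed 0)) = (1/2) *\<^sub>R (ket (Unprimed 1) + ket (Primed 0))"
  by (simp add: shift_ket Chi_Unprimed scaleR_ell2_def ell2.scale_right_distrib)

text \<open>\<open>Unprimed (int (Suc n))\<close> and \<open>Primed n\<close> are equally far from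
  the branching vertex. The factor here equals the one in \<open>shift_ket_Primed\<close>, so the
  two branches stay in step.\<close>

lemma shift_ket_Unprimed_pos:
  "shift (ket (Unprimed (int (Suc n)))) = ((1/2) ^ (2 * n + 3)) *\<^sub>R ket (Unprimed (int (Suc (Suc n))))"
proof -
  have "2 * nat (int (Suc (Suc n))) - 1 = 2 * n + 3" by simp
  then have "weight (Unprimed (int (Suc (Suc n)))) = (1/2) ^ (2 * n + 3)"
    by (simp only: weight.simps) simp
  moreover have "Chi (Unprimed (int (Suc n))) = {Unprimed (int (Suc (Suc n)))}"
    by (simp add: Chi_Unprimed)
  ultimately show ?thesis by (simp add: shift_ket scaleR_ell2_def del: weight.simps of_nat_Suc)
qed

lemma shift_ket_Primed: "shift (ket (Primed n)) = ((1/2) ^ (2 * n + 3)) *\<^sub>R ket (Primed (Suc n))"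
proof -
  have "2 * Suc n + 1 = 2 * n + 3" by simp
  then have w: "weight (Primed (Suc n)) = (1/2) ^ (2 * n + 3)"
    by (simp only: weight.simps)
  have "shift (ket (Primed n)) = weight (Primed (Suc n)) *\<^sub>R ket (Primed (Suc n))"
    by (simp add: shift_ket Chi_Primed scaleR_ell2_def del: weight.simps)
  then show ?thesis by (simp only: w)
qed

lemma shift_power_ket_nonpos:
  "n \<le> k \<Longrightarrow> (shift ^^ n) (ket (Unprimed (- int k))) = ket (Unprimed (int n - int k))"
  by (induction n) (simp_all add: shift_ket_nonpos algebra_simps)

text \<open>Both branches carry the same weights, so the two coefficients remain equal; the
  exponents add up as \<open>1 + 3 + ... + (2 * n + 1) = (Suc n)\<^sup>2\<close>.\<close>

lemma shift_power_ket_0: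
  "(shift ^^ Suc n) (ket (Unprimed 0)) =
     ((1/2) ^ (Suc n)\<^sup>2) *\<^sub>R (ket (Unprimed (int (Suc n))) + ket (Primed n))"
proof (induction n)
  case 0
  show ?case by (simp add: shift_ket_0)
next
  case (Suc n)
  interpret bounded_linear shift by (rule bounded_linear_shift)
  have e: "(Suc (Suc n))\<^sup>2 = (Suc n)\<^sup>2 + (2 * n + 3)"
    by (simp add: power2_eq_square)
  have "(shift ^^ Suc (Suc n)) (ket (Unprimed 0)) = shift ((shift ^^ Suc n) (ket (Unprimed 0)))"
    by simp
  also have "\<dots> = ((1/2) ^ (Suc n)\<^sup>2) *\<^sub>R
      (shift (ket (Unprimed (int (Suc n)))) + shift (ket (Primed n)))"
    by (simp only: Suc.IH add scale)
  also have "\<dots> = ((1/2) ^ (Suc (Suc n))\<^sup>2) *\<^sub>R (ket (Unprimed (int (Suc (Suc n)))) + ket (Primed (Suc n)))"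
    by (simp only: e shift_ket_Unprimed_pos shift_ket_Primed power_add scaleR_add_right[symmetric] scaleR_scaleR)
  finally show ?case .
qed

lemma norm_shift_power_ket_0: "norm ((shift ^^ n) (ket (Unprimed 0))) \<le> 2 * (1/2) ^ n\<^sup>2"
proof (cases n)
  case (Suc l)
  have "norm (ket (Unprimed (int (Suc l))) + ket (Primed l)) \<le> 1 + 1"
    by (rule norm_triangle_le) (simp add: norm_ket)
  then show ?thesis
    unfolding Suc shift_power_ket_0 norm_scaleR by simp
qed (simp add: norm_ket)

text \<open>The path starts beyond the edge into \<open>Primed 0\<close>, so the first odd number is
  missing: \<open>3 + 5 + ... + (2 * n + 1) = n * (n + 2)\<close>.\<close>

lemma shift_power_ket_Primed_0:
  "(shift ^^ n) (ket (Primed 0)) = ((1/2) ^ (n * (n + 2))) *\<^sub>R ket (Primed n)"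
proof (induction n)
  case (Suc n)
  interpret bounded_linear shift by (rule bounded_linear_shift)
  have e: "Suc n * (Suc n + 2) = n * (n + 2) + (2 * n + 3)" by simp
  have "(shift ^^ Suc n) (ket (Primed 0)) = shift ((shift ^^ n) (ket (Primed 0)))"
    by simp
  also have "\<dots> = ((1/2) ^ (n * (n + 2)) * (1/2) ^ (2 * n + 3)) *\<^sub>R ket (Primed (Suc n))"
    by (simp only: Suc.IH scale shift_ket_Primed scaleR_scaleR)
  finally show ?case by (simp only: e power_add)
qed simp


section \<open>The cyclic vector\<close>

definition square_vertex :: "nat \<Rightarrow> vertex" where
  "square_vertex i = Unprimed (- int (i\<^sup>2))"

lemma inj_square_vertex: "inj square_vertex"
  by (auto simp: inj_def square_vertex_def)

text \<open>Square summability depends on \<open>c\<close>, so \<open>Abs_ell2\<close> is applied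
  unconditionally; \<open>Rep_on_squares\<close> justifies it under a geometric bound.\<close>

definition on_squares :: "(nat \<Rightarrow> real) \<Rightarrow> vertex ell2" where
  "on_squares c = Abs_ell2 (\<lambda>v. if v \<in> range square_vertex then of_real (c (inv square_vertex v)) else 0)"

lemma Rep_on_squares:
  assumes "\<And>i. \<bar>c i\<bar> \<le> (1/2) ^ i"
  shows "Rep_ell2 (on_squares c) v =
    (if v \<in> range square_vertex then of_real (c (inv square_vertex v)) else 0)"
proof -
  let ?f = "\<lambda>v. if v \<in> range square_vertex then complex_of_real (c (inv square_vertex v)) else 0"
  have "summable (\<lambda>i. (c i)\<^sup>2)"
  proof (rule summable_comparison_test')
    show "summable (\<lambda>i. (1/4::real) ^ i)" by (rule summable_geometric) simp
    show "norm ((c i)\<^sup>2) \<le> (1/4) ^ i" if "i \<ge> 0" for i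
      using power_mono[OF assms[of i], of 2] by (simp add: power2_eq_square flip: power_mult_distrib)
  qed
  then have "(\<lambda>i. (c i)\<^sup>2) summable_on UNIV"
    by (simp add: summable_nonneg_imp_summable_on)
  then have "(\<lambda>v. (cmod (?f v))\<^sup>2) summable_on range square_vertex"
    by (subst summable_on_reindex[OF inj_square_vertex]) (simp add: o_def inj_square_vertex)
  then have "(\<lambda>v. (cmod (?f v))\<^sup>2) summable_on UNIV"
    by (rule summable_on_cong_neutral[THEN iffD1, rotated -1]) auto
  then show ?thesis by (simp add: on_squares_def Abs_ell2_inverse)
qed

definition square_tail :: "nat \<Rightarrow> vertex ell2" where
  "square_tail j = on_squares (\<lambda>i. if j \<le> i then (1/2) ^ i\<^sup>2 else 0)"

lemma half_power_square_le: "(1/2::real) ^ i\<^sup>2 \<le> (1/2) ^ i"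
  by (rule power_decreasing) (auto simp: power2_eq_square)

lemma Rep_square_tail: "Rep_ell2 (square_tail j) v =
    (if v \<in> range square_vertex \<and> j \<le> inv square_vertex v
     then of_real ((1/2) ^ (inv square_vertex v)\<^sup>2) else 0)"
  unfolding square_tail_def by (subst Rep_on_squares) (use half_power_square_le in auto)

lemma square_tail_Suc:
  "square_tail j = ((1/2) ^ j\<^sup>2) *\<^sub>R ket (square_vertex j) + square_tail (Suc j)"
proof (rule ell2_eqI)
  fix v
  show "Rep_ell2 (square_tail j) v =
      Rep_ell2 (((1/2) ^ j\<^sup>2) *\<^sub>R ket (square_vertex j) + square_tail (Suc j)) v"
  proof (cases "v \<in> range square_vertex")
    case True
    then obtain i where "v = square_vertex i" by auto
    then show ?thesis
      using inj_square_vertex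
      by (cases "i = j") (auto simp: Rep_square_tail plus_ell2.rep_eq Rep_ell2_scaleR ket.rep_eq inj_eq)
  qed (auto simp: Rep_square_tail plus_ell2.rep_eq Rep_ell2_scaleR ket.rep_eq)
qed

lemma square_tail_0:
  "square_tail 0 = (\<Sum>i<j. ((1/2) ^ i\<^sup>2) *\<^sub>R ket (square_vertex i)) + square_tail j"
proof (induction j)
  case (Suc j)
  then show ?case by (simp only: square_tail_Suc[of j] sum.lessThan_Suc add.assoc)
qed simp

text \<open>For \<open>i > j\<close> the inequality \<open>i\<^sup>2 \<ge> j\<^sup>2 + j + i\<close>
  dominates the tail by a fixed geometric vector. The extra factor \<open>(1/2) ^ j\<close> makes
  the tail negligible against the coefficient at \<open>square_vertex j\<close>.\<close>

lemma norm_square_tail_Suc_le: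
  "norm (square_tail (Suc j)) \<le> (1/2) ^ j\<^sup>2 * (1/2) ^ j * norm (on_squares ((^) (1/2)))"
proof (rule norm_ell2_mono)
  fix v
  show "cmod (Rep_ell2 (square_tail (Suc j)) v)
      \<le> (1/2) ^ j\<^sup>2 * (1/2) ^ j * cmod (Rep_ell2 (on_squares ((^) (1/2))) v)"
  proof (cases "v \<in> range square_vertex \<and> Suc j \<le> inv square_vertex v")
    case True
    define i where "i = inv square_vertex v"
    have "j\<^sup>2 + j + i \<le> i\<^sup>2"
    proof -
      have "j < i" using True by (simp add: i_def)
      then obtain d where "i = Suc (j + d)" using less_imp_Suc_add by blast
      then show ?thesis by (simp add: power2_eq_square algebra_simps)
    qed
    then have "(1/2::real) ^ i\<^sup>2 \<le> (1/2) ^ (j\<^sup>2 + j + i)"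
      by (rule power_decreasing) auto
    with True show ?thesis
      by (simp add: Rep_square_tail Rep_on_squares power_add norm_power norm_divide flip: i_def)
  next
    case False
    then have "Rep_ell2 (square_tail (Suc j)) v = 0"
      by (subst Rep_square_tail) (simp only: if_False)
    then show ?thesis by simp
  qed
qed simp

definition cyclic_vector :: "vertex ell2" where
  "cyclic_vector = ket (Primed 0) + square_tail 0"

text \<open>Applied to \<open>cyclic_vector\<close>, the power \<open>shift ^^ (j\<^sup>2 - m)\<close> moves the component at \<open>- j\<^sup>2\<close> to \<open>- m\<close>.
  The components further left are much smaller than this one, and all others have moved far along
  the two branches.\<close>

lemma shift_power_cyclic_vector:
  assumes j: "j \<ge> m + 2"
  shows "norm (2 ^ j\<^sup>2 *\<^sub>R (shift ^^ (j\<^sup>2 - m)) cyclic_vector - ket (Unprimed (- int m)))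
    \<le> (1/2) ^ j * (2 + norm (on_squares ((^) (1/2))))"
proof -
  define n where "n = j\<^sup>2 - m"
  define G where "G = norm (on_squares ((^) (1/2)))"
  define T where "T = shift ^^ n"
  interpret T: bounded_linear T unfolding T_def by (rule bounded_linear_shift_power)
  have jj: "j\<^sup>2 \<ge> 2 * j"
    using j by (simp add: power2_eq_square)
  \<comment> \<open>The natural-number subtraction in \<open>n\<close> is not truncated, because
    \<open>m \<le> j \<le> j\<^sup>2\<close>.\<close>
  have n: "n \<ge> j + 1" "n \<le> j\<^sup>2" "j\<^sup>2 = n + m"
    using j jj by (auto simp: n_def)
  let ?a = "\<lambda>i::nat. (1/2::real) ^ i\<^sup>2"
  \<comment> \<open>Exponents of size \<open>(j + 1)\<^sup>2\<close> or more beat the scale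
    \<open>?a j\<close>, which the factor \<open>2 ^ j\<^sup>2\<close> cancels at the end.\<close>
  have small: "(1/2::real) ^ l \<le> ?a j * (1/2) ^ (2 * j + 1)" if "l \<ge> (j + 1)\<^sup>2" for l
  proof -
    have "j\<^sup>2 + (2 * j + 1) \<le> l" using that by (simp add: power2_eq_square)
    then have "(1/2::real) ^ l \<le> (1/2) ^ (j\<^sup>2 + (2 * j + 1))" by (rule power_decreasing) auto
    then show ?thesis by (simp add: power_add)
  qed
  have Tj: "T (ket (square_vertex j)) = ket (Unprimed (- int m))"
    using n unfolding T_def square_vertex_def by (subst shift_power_ket_nonpos) auto
  have "norm (T (ket (Primed 0))) = (1/2) ^ (n * (n + 2))"
    unfolding T_def by (simp add: shift_power_ket_Primed_0 norm_ket)
  also have "\<dots> \<le> ?a j * (1/2) ^ (2 * j + 1)"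
  proof (rule small)
    have "(j + 1) * (j + 1) \<le> n * (n + 2)" using n(1) by (intro mult_mono) auto
    then show "(j + 1)\<^sup>2 \<le> n * (n + 2)" by (simp add: power2_eq_square)
  qed
  finally have 1: "norm (T (ket (Primed 0))) \<le> ?a j * (1/2) ^ (2 * j + 1)" .
  \<comment> \<open>This component reaches \<open>0\<close> after \<open>i\<^sup>2\<close> steps and
    then runs along the branches for \<open>n - i\<^sup>2\<close> more. That number is at least
    \<open>2 * j - 1 - m\<close>, and \<open>j \<ge> m + 2\<close> turns this into
    \<open>j + 1\<close>.\<close>
  have 2: "norm (T (ket (square_vertex i))) \<le> 2 * (?a j * (1/2) ^ (2 * j + 1))" if "i < j" for i
  proof -
    obtain d where d: "j = Suc (i + d)" using less_imp_Suc_add \<open>i < j\<close> by blast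
    have "i\<^sup>2 + 2 * j \<le> j\<^sup>2 + 1"
      unfolding d by (simp add: power2_eq_square algebra_simps)
    then have l: "i\<^sup>2 + (j + 1) \<le> n" using n(3) j by linarith
    have "T (ket (square_vertex i)) = (shift ^^ (n - i\<^sup>2)) ((shift ^^ i\<^sup>2) (ket (square_vertex i)))"
      using l unfolding T_def by (simp flip: funpow_add comp_apply[of "shift ^^ _" "shift ^^ _"])
    also have "\<dots> = (shift ^^ (n - i\<^sup>2)) (ket (Unprimed 0))"
      unfolding square_vertex_def by (subst shift_power_ket_nonpos) auto
    finally have "norm (T (ket (square_vertex i))) \<le> 2 * (1/2) ^ (n - i\<^sup>2)\<^sup>2"
      using norm_shift_power_ket_0 by simp
    moreover have "(j + 1)\<^sup>2 \<le> (n - i\<^sup>2)\<^sup>2" using l by (intro power_mono) auto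
    ultimately show ?thesis using small by (smt (verit))
  qed
  \<comment> \<open>Bounding the coefficients \<open>?a i\<close> by \<open>1\<close> is enough: the
    factor \<open>(1/2) ^ (2 * j + 1)\<close> outweighs the number \<open>j\<close> of terms, since
    \<open>j < 2 ^ j\<close>.\<close>
  have "norm (\<Sum>i<j. ?a i *\<^sub>R T (ket (square_vertex i))) \<le> (\<Sum>i<j. 2 * (?a j * (1/2) ^ (2 * j + 1)))"
  proof (rule sum_norm_le)
    fix i assume "i \<in> {..<j}"
    moreover have "?a i * norm (T (ket (square_vertex i))) \<le> 1 * norm (T (ket (square_vertex i)))"
      by (intro mult_right_mono) (auto simp: power_le_one)
    ultimately show "norm (?a i *\<^sub>R T (ket (square_vertex i))) \<le> 2 * (?a j * (1/2) ^ (2 * j + 1))"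
      using 2[of i] by simp
  qed
  then have 3: "norm (\<Sum>i<j. ?a i *\<^sub>R T (ket (square_vertex i))) \<le> ?a j * (real j * (1/2) ^ (2 * j))"
    by (simp add: algebra_simps)
  have 4: "norm (T (square_tail (Suc j))) \<le> ?a j * ((1/2) ^ j * G)"
    using norm_square_tail_Suc_le[of j] norm_shift_power_le[of n "square_tail (Suc j)"]
    by (simp add: T_def G_def mult.assoc)
  have "real j * (1/2) ^ j \<le> 1"
    using of_nat_less_two_power[of j, where 'a = real] by (simp add: power_divide)
  then have "(1/2) ^ j * (real j * (1/2) ^ j) \<le> (1/2::real) ^ j * 1"
    by (intro mult_left_mono) auto
  then have 5: "real j * (1/2) ^ (2 * j) \<le> (1/2::real) ^ j"
    unfolding mult_2 power_add by (simp only: mult.left_commute mult_1_right)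
  have 6: "(1/2::real) ^ (2 * j + 1) \<le> (1/2) ^ j"
    by (rule power_decreasing) auto
  \<comment> \<open>\<open>E\<close> collects everything except the main term
    \<open>Tj\<close>.\<close>
  define E where "E = T (ket (Primed 0)) + (\<Sum>i<j. ?a i *\<^sub>R T (ket (square_vertex i))) + T (square_tail (Suc j))"
  have "T cyclic_vector = ?a j *\<^sub>R ket (Unprimed (- int m)) + E"
    unfolding cyclic_vector_def square_tail_0[of j] square_tail_Suc[of j] E_def
    by (simp add: T.add T.sum T.scale Tj algebra_simps)
  then have E: "2 ^ j\<^sup>2 *\<^sub>R T cyclic_vector - ket (Unprimed (- int m)) = 2 ^ j\<^sup>2 *\<^sub>R E"
    by (simp add: scaleR_add_right flip: power_mult_distrib)
  have "norm E \<le> ?a j * ((1/2) ^ (2 * j + 1) + real j * (1/2) ^ (2 * j) + (1/2) ^ j * G)"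
    using 1 3 4 norm_triangle_ineq[of "T (ket (Primed 0)) + (\<Sum>i<j. ?a i *\<^sub>R T (ket (square_vertex i)))" "T (square_tail (Suc j))"]
      norm_triangle_ineq[of "T (ket (Primed 0))" "(\<Sum>i<j. ?a i *\<^sub>R T (ket (square_vertex i)))"]
    unfolding E_def by (simp add: distrib_left)
  also have "\<dots> \<le> ?a j * ((1/2) ^ j * (2 + G))"
    using 5 6 by (intro mult_left_mono) (auto simp: distrib_left)
  finally have "norm (2 ^ j\<^sup>2 *\<^sub>R T cyclic_vector - ket (Unprimed (- int m)))
      \<le> 2 ^ j\<^sup>2 * (?a j * ((1/2) ^ j * (2 + G)))"
    unfolding E norm_scaleR by (simp add: mult_left_mono)
  also have "\<dots> = (1/2) ^ j * (2 + G)"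
    by (simp add: power_divide)
  finally show ?thesis by (simp add: T_def n_def G_def)
qed

section \<open>Cyclicity: all basis vectors lie in the closed span of the orbit\<close>

lemma cyclic_shift: "cyclic shift"
proof -
  define M where "M = ell2.span (range (\<lambda>n. (shift ^^ n) cyclic_vector))"
  define K where "K = closure M"
  let ?G = "norm (on_squares ((^) (1/2)))"
  have K: "ell2.subspace K"
    unfolding K_def M_def by (intro ell2_subspace_closure ell2.subspace_span)
  then have K_scaleR: "r *\<^sub>R x \<in> K" if "x \<in> K" for r x
    using that by (simp add: scaleR_ell2_def ell2.subspace_scale)
  have inv: "shift x \<in> K" if "x \<in> K" for x
    using that unfolding K_def M_def by (intro orbit_closure_invariant bounded_operator_shift)
  \<comment> \<open>This null sequence dominates both the error in approximating
    \<open>ket (Unprimed (- int m))\<close>, once \<open>j \<ge> m + 2\<close>, and the norms of the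
    tails.\<close>
  have lim0: "(\<lambda>j. (1/2) ^ j * (2 + ?G)) \<longlonglongrightarrow> 0"
    by (intro tendsto_mult_left_zero LIMSEQ_power_zero) simp
  have neg: "ket (Unprimed (- int m)) \<in> K" for m
    unfolding K_def
  proof (rule closure_sequential[THEN iffD2], intro exI conjI allI)
    let ?y = "\<lambda>j. 2 ^ j\<^sup>2 *\<^sub>R (shift ^^ (j\<^sup>2 - m)) cyclic_vector"
    show "?y j \<in> M" for j
      unfolding scaleR_ell2_def M_def by (intro ell2.span_scale ell2.span_base) auto
    have "(\<lambda>j. ?y j - ket (Unprimed (- int m))) \<longlonglongrightarrow> 0"
    proof (rule tendsto_0_le[OF lim0, of _ 1])
      show "\<forall>\<^sub>F j in sequentially. norm (?y j - ket (Unprimed (- int m)))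
          \<le> norm ((1/2) ^ j * (2 + ?G)) * 1"
        using eventually_ge_at_top[of "m + 2"]
      proof eventually_elim
        case (elim j)
        then show ?case
          using shift_power_cyclic_vector[OF elim] abs_ge_self order_trans by simp
      qed
    qed
    then show "?y \<longlonglongrightarrow> ket (Unprimed (- int m))"
      by (simp add: LIM_zero_iff)
  qed
  \<comment> \<open>The partial sums involve only basis vectors covered by \<open>neg\<close>, and
    the remainders tend to \<open>0\<close>.\<close>
  have "square_tail 0 \<in> K"
  proof (rule closed_sequentially)
    show "closed K" by (simp add: K_def)
    let ?y = "\<lambda>j. \<Sum>i<Suc j. ((1/2) ^ i\<^sup>2) *\<^sub>R ket (square_vertex i)"
    show "?y j \<in> K" for j
      unfolding square_vertex_def by (intro ell2.subspace_sum K K_scaleR neg)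
    have "(\<lambda>j. square_tail (Suc j)) \<longlonglongrightarrow> 0"
    proof (rule tendsto_0_le[OF lim0, of _ 1], intro always_eventually allI)
      fix j
      have "(1/2) ^ j\<^sup>2 * (1/2) ^ j * ?G \<le> 1 * (1/2) ^ j * (2 + ?G)"
        by (intro mult_mono) (auto simp: power_le_one)
      then show "norm (square_tail (Suc j)) \<le> norm ((1/2) ^ j * (2 + ?G)) * 1"
        using norm_square_tail_Suc_le[of j] unfolding mult_1_left mult_1_right real_norm_def by linarith
    qed
    then have "(\<lambda>j. square_tail 0 - square_tail (Suc j)) \<longlonglongrightarrow> square_tail 0 - 0"
      by (intro tendsto_diff tendsto_const)
    moreover have "square_tail 0 - square_tail (Suc j) = ?y j" for j
      by (simp only: square_tail_0[of "Suc j"] add_diff_cancel_right')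
    ultimately show "?y \<longlonglongrightarrow> square_tail 0"
      by (simp only: diff_zero)
  qed
  moreover have "cyclic_vector \<in> K"
    unfolding K_def M_def
    by (intro subsetD[OF closure_subset] ell2.span_base) (auto intro: range_eqI[of _ _ 0])
  ultimately have "cyclic_vector - square_tail 0 \<in> K"
    by (rule ell2.subspace_diff[OF K, rotated])
  then have P0: "ket (Primed 0) \<in> K"
    by (simp add: cyclic_vector_def)
  \<comment> \<open>The weights are nonzero, so they can be divided out after the shift has been
    applied.\<close>
  have cancel: "x \<in> K" if "r *\<^sub>R x \<in> K" "r \<noteq> 0" for r x
    using K_scaleR[OF that(1), of "inverse r"] that(2) by simp
  have P: "ket (Primed n) \<in> K" for n
  proof (induction n)
    case (Suc n)
    then show ?case using inv[OF Suc] unfolding shift_ket_Primed by (rule_tac cancel) auto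
  qed (rule P0)
  have U: "ket (Unprimed (int (Suc n))) \<in> K" for n
  proof (induction n)
    case 0
    have "ket (Unprimed 1) + ket (Primed 0) \<in> K"
      using inv[OF neg[of 0]] unfolding of_nat_0 minus_zero shift_ket_0 by (rule cancel) simp
    from ell2.subspace_diff[OF K this P0] show ?case by simp
  next
    case (Suc n)
    show ?case using inv[OF Suc] unfolding shift_ket_Unprimed_pos by (rule cancel) simp
  qed
  have "ket v \<in> K" for v
  proof (cases v)
    case (Unprimed k)
    \<comment> \<open>\<open>U\<close> starts at the vertex \<open>1\<close>, hence the index
      \<open>nat k - 1\<close> for positive \<open>k\<close>.\<close>
    then show ?thesis
      using neg[of "nat (- k)"] U[of "nat k - 1"] by (cases "k \<le> 0") (auto simp: Suc_diff_1)
  qed (simp add: P)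
  then have "ell2.span (range ket) \<subseteq> K"
    by (intro ell2.span_minimal K) auto
  then have "closure (ell2.span (range ket)) \<subseteq> K"
    by (rule closure_minimal) (simp add: K_def)
  then show ?thesis
    unfolding cyclic_def closure_span_ket K_def M_def by blast
qed

theorem theorem8p4:
  shows "\<exists>(lam :: vertex \<Rightarrow> real) (S :: vertex ell2 \<Rightarrow> vertex ell2). weighted_shift lam S \<and> cyclic S"
  using weighted_shift_shift cyclic_shift by blast

end
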